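(* Let $(X_s, s\ge 0)$ be an $\mathbb{R}^d$-valued process with right-continuous sample paths, and let $(\tau_\ell, \ell\ge 0)$ be a stable subordinator with index $\alpha\in(0,1)$; $X$ and $\tau$ are not required to be independent. Set $Y_u=\int_0^u X_s\,\mathrm{d}s$ for $u\ge 0$, and consider the right-continuous time-changed processes $\hat X_\ell = X_{\tau_\ell}$ and $\hat Y_\ell = Y_{\tau_\ell}$, $\ell\ge 0$. Then the right-continuous filtration $(\hat{\mathcal{Y}}_\ell,\ell\ge 0)$ generated by the process $(\hat Y_\ell,\ell\ge 0)$ contains the right-continuous filtration $(\hat{\mathcal{X}}_\ell,\ell\ge 0)$ generated by $(\hat X_\ell,\ell\ge 0)$.
   Context: A stable subordinator with index $\alpha\in(0,1)$ is a right-continuous increasing process $(\tau_\ell,\ell\ge0)$ with $\tau_0=0$ and stationary independent increments, such that $\mathbb{E}(e^{-q\tau_\ell})=\exp(-c\,\ell\, q^\alpha)$ for all $q,\ell\ge 0$, for some constant $c>0$. The right-continuous filtration generated by a process $(Z_\ell,\ell\ge 0)$ is the smallest right-continuous filtration to which $Z$ is adapted, i.e. its $\sigma$-field at index $\ell$ is $\bigcap_{\varepsilon>0}\sigma(Z_\lambda:\ 0\le\lambda\le \ell+\varepsilon)$. One filtration contains another if, for every index $\ell\ge 0$, the $\sigma$-field at index $\ell$ of the former contains that of the latter, here $\hat{\mathcal{X}}_\ell\subseteq\hat{\mathcal{Y}}_\ell$.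
   Formalization: The containment is proved after removing one null event, common to all indices, from the sample space (without this it fails, since paths on null events are arbitrary); X is assumed Lebesgue integrable on each [0,u], so that Y is defined. *)

theory Defs
  imports "HOL-Probability.Probability"
begin

definition (in prob_space) stable_subordinator :: "real \<Rightarrow> (real \<Rightarrow> 'a \<Rightarrow> real) \<Rightarrow> bool" where
  "stable_subordinator \<alpha> \<tau> \<longleftrightarrow>
     0 < \<alpha> \<and> \<alpha> < 1 \<and>
     (\<forall>l\<ge>0. random_variable borel (\<tau> l)) \<and>
     (\<forall>\<omega>\<in>space M. \<tau> 0 \<omega> = 0) \<and>
     (\<forall>\<omega>\<in>space M. mono_on {0..} (\<lambda>l. \<tau> l \<omega>)) \<and>
     (\<forall>\<omega>\<in>space M. \<forall>l\<ge>0. continuous (at_right l) (\<lambda>l. \<tau> l \<omega>)) \<and>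
     (\<forall>l\<ge>0. \<forall>h\<ge>0. distr M borel (\<lambda>\<omega>. \<tau> (l + h) \<omega> - \<tau> l \<omega>) =
                    distr M borel (\<lambda>\<omega>. \<tau> h \<omega> - \<tau> 0 \<omega>)) \<and>
     (\<forall>n. \<forall>t :: nat \<Rightarrow> real. 0 \<le> t 0 \<and> mono_on {..n} t \<longrightarrow>
        indep_vars (\<lambda>_. borel) (\<lambda>i \<omega>. \<tau> (t (Suc i)) \<omega> - \<tau> (t i) \<omega>) {..<n}) \<and>
     (\<exists>c>0. \<forall>q\<ge>0. \<forall>l\<ge>0. expectation (\<lambda>\<omega>. exp (- q * \<tau> l \<omega>)) = exp (- c * l * q powr \<alpha>))"

definition integral_process ::
    "(real \<Rightarrow> 'a \<Rightarrow> 'b::{banach, second_countable_topology}) \<Rightarrow> real \<Rightarrow> 'a \<Rightarrow> 'b" where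
  "integral_process X u \<omega> = (LINT s:{0..u}|lborel. X s \<omega>)"

definition time_change :: "(real \<Rightarrow> 'a \<Rightarrow> 'b) \<Rightarrow> (real \<Rightarrow> 'a \<Rightarrow> real) \<Rightarrow> real \<Rightarrow> 'a \<Rightarrow> 'b" where
  "time_change Z \<tau> l \<omega> = Z (\<tau> l \<omega>) \<omega>"

text \<open>The members of the \<open>\<sigma>\<close>-field at index \<open>l\<close> of the right-continuous filtration generated by
  \<open>Z\<close>, viewed as a process on the sample space \<open>\<Omega>\<close>. No null sets are added.\<close>

definition rc_filtration ::
    "'a set \<Rightarrow> (real \<Rightarrow> 'a \<Rightarrow> 'b::topological_space) \<Rightarrow> real \<Rightarrow> 'a set set" where
  "rc_filtration \<Omega> Z l =
     (\<Inter>\<epsilon>\<in>{0<..}. sigma_sets \<Omega> {Z k -` A \<inter> \<Omega> | k A. k \<in> {0..l + \<epsilon>} \<and> A \<in> sets borel})"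

text \<open>Containment of the generated filtrations almost surely, that is, exact containment at
  every index once one fixed null event has been removed from the sample space. For every \<open>l\<close> it
  implies the inclusion \<open>rc_filtration (space M) Z l \<subseteq> sigma_sets (space M)
  (rc_filtration (space M) W l \<union> null_sets M)\<close> in the filtration augmented by the null sets (if
  the \<open>Z k\<close>, \<open>W k\<close> with \<open>k \<ge> 0\<close> are measurable).
  Removing a null event cannot be avoided for the processes of interest, since on a null
  event the paths of a subordinator are arbitrary apart from being increasing and right-continuous:
  if \<open>\<tau>\<^sub>l = l\<close> and \<open>X = 2\<close> at one point of a null event, and \<open>\<tau>\<^sub>l = 2 l\<close> and \<open>X = 1\<close> at another one,
  then the time-changed integral is \<open>2 l\<close> at both points, but the time-changed \<open>X\<close> separates them.\<close>

definition ae_contains_filtration ::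
    "'a measure \<Rightarrow> (real \<Rightarrow> 'a \<Rightarrow> 'b::topological_space) \<Rightarrow>
       (real \<Rightarrow> 'a \<Rightarrow> 'c::topological_space) \<Rightarrow> bool" where
  "ae_contains_filtration M W Z \<longleftrightarrow>
     (\<exists>N\<in>null_sets M. \<forall>l\<ge>0. rc_filtration (space M - N) Z l \<subseteq> rc_filtration (space M - N) W l)"

end

theory Submission
  imports Defs
begin

text \<open>
  Just after the time \<open>\<tau> k\<close> the path of \<open>X\<close> is nearly constant, by right-continuity, and so every
  increment of \<open>Y\<^sub>\<tau>\<close> over a short window to the right of \<open>k\<close> is nearly \<open>X\<^bsub>\<tau> k\<^esub>\<close> times the
  corresponding increment of \<open>\<tau>\<close>. The increments of \<open>\<tau>\<close> cannot be read off from \<open>Y\<^sub>\<tau>\<close>, but their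
  distribution is known: cut a window of length \<open>h\<close> into \<open>2\<^sup>n\<close> equal pieces, and by stability the
  increments of \<open>\<tau>\<close> over the pieces, multiplied by \<open>(h / 2\<^sup>n)\<^bsup>-1/\<alpha>\<^esup>\<close>, are independent copies of
  \<open>\<tau>\<^sub>1\<close>. Hence a law of large numbers determines the factor in front of them.

  To bring the unknown factor under control, work with one coordinate \<open>X \<bullet> b\<close> and apply a bounded
  increasing function to each rescaled increment before averaging. With
  \<open>saturate y = sgn y * (1 - exp (-\<bar>y\<bar>))\<close> the average over the pieces for \<open>p * \<tau>\<close>, with a constant
  \<open>p\<close>, tends almost surely to \<open>g p = sgn p * (1 - exp (-c * \<bar>p\<bar>\<^bsup>\<alpha>\<^esup>))\<close>, since only the Laplace
  transform of \<open>\<tau>\<close> enters (\<open>stable_subordinator_rescaled_mean_tendsto\<close>). The function \<open>g\<close> is strictly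
  increasing. The averages are monotone in the increments, and \<open>\<tau>\<close> increases; so if \<open>X \<bullet> b\<close>
  stays between \<open>p\<close> and \<open>q\<close> on the time span of a window, then the averages for \<open>Y\<^sub>\<tau> \<bullet> b\<close> are
  squeezed between those for \<open>p * \<tau>\<close> and for \<open>q * \<tau>\<close>, path by path.
  Shrinking the window to \<open>k\<close> yields a description of the event \<open>r < X\<^bsub>\<tau> k\<^esub> \<bullet> b\<close> by countable
  operations on increments of \<open>Y\<^sub>\<tau>\<close> in arbitrarily short windows after \<open>k\<close> (\<open>less_time_change_iff\<close>).

  The windows and the constants \<open>p\<close> may be taken rational. So one null event serves all of them,
  and therefore all indices \<open>k\<close> at once; off this event the description is an identity between sets,
  which is why the filtrations are contained in one another exactly there.
\<close>

section \<open>A law of large numbers for triangular arrays\<close>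

context prob_space begin

lemma second_moment_sum_indep:
  fixes W :: "'i \<Rightarrow> 'a \<Rightarrow> real"
  assumes fin: "finite I"
    and indep: "indep_vars (\<lambda>_. borel) W I"
    and bound: "\<And>i \<omega>. i \<in> I \<Longrightarrow> \<omega> \<in> space M \<Longrightarrow> \<bar>W i \<omega>\<bar> \<le> 1"
    and mean: "\<And>i. i \<in> I \<Longrightarrow> expectation (W i) = 0"
  shows "expectation (\<lambda>\<omega>. (\<Sum>i\<in>I. W i \<omega>)\<^sup>2) \<le> card I"
proof -
  have rv [measurable]: "W i \<in> borel_measurable M" if "i \<in> I" for i
    using indep that by (auto simp: indep_vars_def)
  have int: "integrable M (W i)" if "i \<in> I" for i
    using that bound by (intro integrable_const_bound[of _ 1]) auto
  have int2: "integrable M (\<lambda>\<omega>. W i \<omega> * W j \<omega>)" if "i \<in> I" "j \<in> I" for i j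
    using that bound by (intro integrable_const_bound[of _ 1]) (auto simp: abs_mult intro!: mult_le_one)
  have cross: "expectation (\<lambda>\<omega>. W i \<omega> * W j \<omega>) = 0" if "i \<in> I" "j \<in> I" "i \<noteq> j" for i j
  proof -
    have "expectation (\<lambda>\<omega>. \<Prod>k\<in>{i, j}. W k \<omega>) = (\<Prod>k\<in>{i, j}. expectation (W k))"
      using that by (intro indep_vars_lebesgue_integral indep_vars_subset[OF indep] int) auto
    then show ?thesis
      using that mean by simp
  qed
  have diag: "expectation (\<lambda>\<omega>. W i \<omega> * W i \<omega>) \<le> 1" if "i \<in> I" for i
  proof -
    have "expectation (\<lambda>\<omega>. W i \<omega> * W i \<omega>) \<le> expectation (\<lambda>\<omega>. 1)"
    proof (intro integral_mono int2 that)
      fix \<omega> assume "\<omega> \<in> space M"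
      then have "\<bar>W i \<omega>\<bar> * \<bar>W i \<omega>\<bar> \<le> 1"
        using bound that by (intro mult_le_one) auto
      then show "W i \<omega> * W i \<omega> \<le> 1" by simp
    qed auto
    then show ?thesis by (simp add: prob_space)
  qed
  have "expectation (\<lambda>\<omega>. (\<Sum>i\<in>I. W i \<omega>)\<^sup>2) = (\<Sum>i\<in>I. \<Sum>j\<in>I. expectation (\<lambda>\<omega>. W i \<omega> * W j \<omega>))"
    by (simp add: power2_eq_square sum_product int2 Bochner_Integration.integral_sum
        Bochner_Integration.integrable_sum)
  also have "\<dots> = (\<Sum>i\<in>I. \<Sum>j\<in>I. if j = i then expectation (\<lambda>\<omega>. W i \<omega> * W i \<omega>) else 0)"
    using cross by (intro sum.cong refl) auto
  also have "\<dots> = (\<Sum>i\<in>I. expectation (\<lambda>\<omega>. W i \<omega> * W i \<omega>))"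
    using fin by (simp)
  also have "\<dots> \<le> (\<Sum>i\<in>I. 1)"
    by (intro sum_mono diag)
  finally show ?thesis by simp
qed

text \<open>The expected sum of all squared deviations is finite, so almost surely that sum converges and
  its terms vanish.\<close>

lemma AE_tendsto_of_summable_second_moments:
  fixes Z :: "nat \<Rightarrow> 'a \<Rightarrow> real"
  assumes rv [measurable]: "\<And>n. Z n \<in> borel_measurable M"
    and int: "\<And>n. integrable M (\<lambda>\<omega>. (Z n \<omega> - m)\<^sup>2)"
    and le: "\<And>n. expectation (\<lambda>\<omega>. (Z n \<omega> - m)\<^sup>2) \<le> b n"
    and sum: "summable b"
  shows "AE \<omega> in M. (\<lambda>n. Z n \<omega>) \<longlonglongrightarrow> m"
proof -
  have "(\<integral>\<^sup>+\<omega>. (\<Sum>n. ennreal ((Z n \<omega> - m)\<^sup>2)) \<partial>M) = (\<Sum>n. \<integral>\<^sup>+\<omega>. ennreal ((Z n \<omega> - m)\<^sup>2) \<partial>M)"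
    by (intro nn_integral_suminf) measurable
  also have "\<dots> = (\<Sum>n. ennreal (expectation (\<lambda>\<omega>. (Z n \<omega> - m)\<^sup>2)))"
    using int by (subst nn_integral_eq_integral) auto
  also have "\<dots> \<le> (\<Sum>n. ennreal (b n))"
    by (intro suminf_le ennreal_leI le summableI)
  also have "\<dots> = ennreal (suminf b)"
  proof (rule suminf_ennreal2[OF _ sum])
    show "0 \<le> b n" for n
      by (rule order.trans[OF _ le]) simp
  qed
  finally have "(\<integral>\<^sup>+\<omega>. (\<Sum>n. ennreal ((Z n \<omega> - m)\<^sup>2)) \<partial>M) \<noteq> \<infinity>"
    by (auto simp: top_unique)
  then have "AE \<omega> in M. (\<Sum>n. ennreal ((Z n \<omega> - m)\<^sup>2)) \<noteq> \<infinity>"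
    by (intro nn_integral_PInf_AE) measurable
  then show ?thesis
  proof eventually_elim
    case (elim \<omega>)
    then have "summable (\<lambda>n. (Z n \<omega> - m)\<^sup>2)"
      by (intro summable_suminf_not_top) auto
    then have "(\<lambda>n. (Z n \<omega> - m)\<^sup>2) \<longlonglongrightarrow> 0"
      by (rule summable_LIMSEQ_zero)
    then have "(\<lambda>n. Z n \<omega> - m) \<longlonglongrightarrow> 0"
      by (simp add: power_tendsto_0_iff)
    then show ?case
      by (simp add: LIM_zero_iff)
  qed
qed

text \<open>Row \<open>n\<close> has \<open>2\<^sup>n\<close> entries, so the mean square deviation of its average from \<open>m\<close> is at most
  \<open>2\<^bsup>-n\<^esup>\<close>, which is summable over the rows.\<close>

lemma dyadic_array_lln:
  fixes V :: "nat \<Rightarrow> nat \<Rightarrow> 'a \<Rightarrow> real"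
  assumes indep: "\<And>n. indep_vars (\<lambda>_. borel) (V n) {..<2 ^ n}"
    and bound: "\<And>n i \<omega>. i < 2 ^ n \<Longrightarrow> \<omega> \<in> space M \<Longrightarrow> V n i \<omega> \<in> {0..1}"
    and mean: "\<And>n i. i < 2 ^ n \<Longrightarrow> expectation (V n i) = m"
  shows "AE \<omega> in M. (\<lambda>n. (\<Sum>i<2 ^ n. V n i \<omega>) / 2 ^ n) \<longlonglongrightarrow> m"
proof (rule AE_tendsto_of_summable_second_moments)
  have rv [measurable]: "V n i \<in> borel_measurable M" if "i < 2 ^ n" for n i
    using indep[of n] that by (auto simp: indep_vars_def)
  have int: "integrable M (V n i)" if "i < 2 ^ n" for n i
    using that bound by (intro integrable_const_bound[of _ 1]) (auto intro!: AE_I2)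
  have m: "0 \<le> m" "m \<le> 1"
  proof -
    have "expectation (V 0 0) \<le> expectation (\<lambda>_. 1)"
      using bound[of 0 0] by (intro integral_mono int) auto
    moreover have "0 \<le> expectation (V 0 0)"
      using bound[of 0 0] by (intro Bochner_Integration.integral_nonneg) auto
    ultimately show "0 \<le> m" "m \<le> 1" 
      using mean[of 0 0] by (simp_all add: prob_space)
  qed
  show rvs: "(\<lambda>\<omega>. (\<Sum>i<2 ^ n. V n i \<omega>) / 2 ^ n) \<in> borel_measurable M" for n
    by measurable
  have centred: "(\<Sum>i<2 ^ n. V n i \<omega>) / 2 ^ n - m = (\<Sum>i<2 ^ n. V n i \<omega> - m) / 2 ^ n" for n \<omega>
    by (simp add: sum_subtractf diff_divide_distrib)
  have dev: "\<bar>V n i \<omega> - m\<bar> \<le> 1" if "i < 2 ^ n" "\<omega> \<in> space M" for n i \<omega>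
    using bound[OF that] m by auto
  show "integrable M (\<lambda>\<omega>. ((\<Sum>i<2 ^ n. V n i \<omega>) / 2 ^ n - m)\<^sup>2)" for n
  proof (rule integrable_const_bound[of _ 1])
    have "((\<Sum>i<2 ^ n. V n i \<omega>) / 2 ^ n - m)\<^sup>2 \<le> 1" if "\<omega> \<in> space M" for \<omega>
    proof -
      have "\<bar>\<Sum>i<2 ^ n. V n i \<omega> - m\<bar> \<le> (\<Sum>i<(2 :: nat) ^ n. 1)"
        using dev that by (intro order.trans[OF sum_abs] sum_mono) auto
      then show ?thesis
        unfolding centred by (simp add: abs_square_le_1 abs_divide)
    qed
    then show "AE \<omega> in M. norm (((\<Sum>i<2 ^ n. V n i \<omega>) / 2 ^ n - m)\<^sup>2) \<le> 1"
      by (auto intro!: AE_I2)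
  qed (use rvs[of n] in measurable)
  show "expectation (\<lambda>\<omega>. ((\<Sum>i<2 ^ n. V n i \<omega>) / 2 ^ n - m)\<^sup>2) \<le> (1 / 2) ^ n" for n
  proof -
    have "expectation (\<lambda>\<omega>. (\<Sum>i<2 ^ n. V n i \<omega> - m)\<^sup>2) \<le> card {..<(2::nat) ^ n}"
    proof (rule second_moment_sum_indep)
      show "indep_vars (\<lambda>_. borel) (\<lambda>i \<omega>. V n i \<omega> - m) {..<2 ^ n}"
        by (rule indep_vars_compose2[OF indep]) measurable
      show "expectation (\<lambda>\<omega>. V n i \<omega> - m) = 0" if "i \<in> {..<2 ^ n}" for i
        using that int mean by (simp add: prob_space)
    qed (use dev in auto)
    then have "expectation (\<lambda>\<omega>. (\<Sum>i<2 ^ n. V n i \<omega> - m)\<^sup>2) / (2 ^ n)\<^sup>2 \<le> 2 ^ n / (2 ^ n)\<^sup>2"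
      by (intro divide_right_mono) auto
    then show ?thesis
      by (simp add: centred power_divide power2_eq_square)
  qed
  show "summable (\<lambda>n. (1 / 2 :: real) ^ n)"
    by (rule summable_geometric) simp
qed

end

section \<open>Averages of saturated increments\<close>

text \<open>Boundedness keeps the variances bounded although stable variables have none, and the odd symmetric
  form retains the sign of the factor in front of \<open>\<tau>\<close>. On one side of \<open>0\<close> the function is
  affine in an exponential, whose mean is the Laplace transform.\<close>

definition saturate :: "real \<Rightarrow> real" where
  "saturate y = sgn y * (1 - exp (- \<bar>y\<bar>))"

lemma saturate_strict_mono: "strict_mono saturate"
proof (rule strict_monoI)
  fix x y :: real
  assume "x < y"
  consider "0 \<le> x" | "x < 0" "0 < y" | "y \<le> 0" by linarith
  then show "saturate x < saturate y"
  proof cases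
    case 1
    then show ?thesis using \<open>x < y\<close> by (auto simp: saturate_def sgn_if)
  next
    case 2
    then have "saturate x < 0" "0 < saturate y" by (auto simp: saturate_def)
    then show ?thesis by linarith
  next
    case 3
    then show ?thesis using \<open>x < y\<close> by (auto simp: saturate_def sgn_if)
  qed
qed

lemma saturate_mult_nonneg: "0 \<le> y \<Longrightarrow> saturate (p * y) = sgn p * (1 - exp (- \<bar>p\<bar> * y))"
  by (cases "y = 0") (auto simp: saturate_def sgn_mult abs_mult)

lemma borel_measurable_saturate [measurable]: "saturate \<in> borel_measurable borel"
  unfolding saturate_def [abs_def] by measurable

definition grid :: "real \<Rightarrow> real \<Rightarrow> nat \<Rightarrow> nat \<Rightarrow> real" where
  "grid a h n j = a + real j * (h / 2 ^ n)"

text \<open>The factor \<open>(h / 2\<^sup>n)\<^bsup>-1/\<alpha>\<^esup>\<close> is the self-similar scaling of an \<open>\<alpha>\<close>-stable subordinator: it gives the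
  increment over a piece of length \<open>h / 2\<^sup>n\<close> the law of \<open>\<tau>\<^sub>1\<close>.\<close>

definition rescaled_mean :: "real \<Rightarrow> real \<Rightarrow> real \<Rightarrow> nat \<Rightarrow> (real \<Rightarrow> real) \<Rightarrow> real" where
  "rescaled_mean \<alpha> a h n Z =
     (\<Sum>j<2 ^ n. saturate ((h / 2 ^ n) powr (- 1 / \<alpha>) * (Z (grid a h n (Suc j)) - Z (grid a h n j)))) / 2 ^ n"

lemma mono_grid: "0 \<le> h \<Longrightarrow> mono (grid a h n)"
  by (auto simp: grid_def intro!: monoI mult_right_mono divide_right_mono)

lemma grid_le: "0 \<le> h \<Longrightarrow> j \<le> 2 ^ n \<Longrightarrow> grid a h n j \<le> a + h"
proof -
  assume "0 \<le> h" "j \<le> 2 ^ n"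
  then have "grid a h n j \<le> grid a h n (2 ^ n)"
    using mono_grid[of h a n] by (auto dest: monoD)
  then show ?thesis by (simp add: grid_def)
qed

lemma grid_ge: "0 \<le> h \<Longrightarrow> a \<le> grid a h n j"
  by (simp add: grid_def)

lemma rescaled_mean_mono:
  assumes "\<And>u v. a \<le> u \<Longrightarrow> u \<le> v \<Longrightarrow> v \<le> a + h \<Longrightarrow> Z v - Z u \<le> Z' v - Z' u" and "0 \<le> h"
  shows "rescaled_mean \<alpha> a h n Z \<le> rescaled_mean \<alpha> a h n Z'"
  unfolding rescaled_mean_def
proof (intro divide_right_mono sum_mono)
  fix j :: nat assume "j \<in> {..<2 ^ n}"
  then have "Z (grid a h n (Suc j)) - Z (grid a h n j) \<le> Z' (grid a h n (Suc j)) - Z' (grid a h n j)"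
    using assms(2) by (intro assms(1) grid_ge grid_le monoD[OF mono_grid]) auto
  then show "saturate ((h / 2 ^ n) powr (- 1 / \<alpha>) * (Z (grid a h n (Suc j)) - Z (grid a h n j)))
      \<le> saturate ((h / 2 ^ n) powr (- 1 / \<alpha>) * (Z' (grid a h n (Suc j)) - Z' (grid a h n j)))"
    by (simp add: strict_mono_less_eq[OF saturate_strict_mono] mult_left_mono)
qed auto

context prob_space begin

text \<open>The scaling factor cancels the length \<open>\<delta>\<close> of the increment because
  \<open>\<delta> * (\<delta>\<^bsup>-1/\<alpha>\<^esup>)\<^bsup>\<alpha>\<^esup> = 1\<close>.\<close>

lemma stable_increment_laplace:
  fixes \<tau> :: "real \<Rightarrow> 'a \<Rightarrow> real"
  assumes rv: "\<And>l. 0 \<le> l \<Longrightarrow> random_variable borel (\<tau> l)"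
    and zero: "\<And>\<omega>. \<omega> \<in> space M \<Longrightarrow> \<tau> 0 \<omega> = 0"
    and stat: "distr M borel (\<lambda>\<omega>. \<tau> (l + \<delta>) \<omega> - \<tau> l \<omega>) = distr M borel (\<lambda>\<omega>. \<tau> \<delta> \<omega> - \<tau> 0 \<omega>)"
    and lap: "\<And>q. 0 \<le> q \<Longrightarrow> expectation (\<lambda>\<omega>. exp (- q * \<tau> \<delta> \<omega>)) = exp (- c * \<delta> * q powr \<alpha>)"
    and "0 \<le> l" "0 < \<delta>" "0 < \<alpha>" "0 \<le> q"
  shows "expectation (\<lambda>\<omega>. exp (- q * (\<delta> powr (- 1 / \<alpha>) * (\<tau> (l + \<delta>) \<omega> - \<tau> l \<omega>)))) = exp (- c * q powr \<alpha>)"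
proof -
  define f where "f = (\<lambda>y :: real. exp (- q * (\<delta> powr (- 1 / \<alpha>) * y)))"
  have [measurable]: "f \<in> borel_measurable borel"
    by (simp add: f_def)
  have [measurable]: "\<tau> (l + \<delta>) \<in> borel_measurable M" "\<tau> l \<in> borel_measurable M"
    "\<tau> \<delta> \<in> borel_measurable M" "\<tau> 0 \<in> borel_measurable M"
    using assms by auto
  have "expectation (\<lambda>\<omega>. f (\<tau> (l + \<delta>) \<omega> - \<tau> l \<omega>)) = expectation (\<lambda>\<omega>. f (\<tau> \<delta> \<omega> - \<tau> 0 \<omega>))"
    using arg_cong[OF stat, of "\<lambda>D. integral\<^sup>L D f"] by (simp add: integral_distr)
  also have "\<dots> = expectation (\<lambda>\<omega>. exp (- (q * \<delta> powr (- 1 / \<alpha>)) * \<tau> \<delta> \<omega>))"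
    by (intro Bochner_Integration.integral_cong refl) (simp add: f_def zero)
  also have "\<dots> = exp (- c * \<delta> * (q * \<delta> powr (- 1 / \<alpha>)) powr \<alpha>)"
    using assms by (intro lap) auto
  also have "\<delta> * (q * \<delta> powr (- 1 / \<alpha>)) powr \<alpha> = q powr \<alpha>"
    using \<open>0 < \<delta>\<close> \<open>0 < \<alpha>\<close> \<open>0 \<le> q\<close> by (simp add: powr_minus_divide powr_divide powr_powr)
  then have "- c * \<delta> * (q * \<delta> powr (- 1 / \<alpha>)) powr \<alpha> = - c * q powr \<alpha>"
    by (simp add: mult.assoc)
  finally show ?thesis by (simp add: f_def)
qed

text \<open>For a constant factor \<open>p\<close> the saturated increments are an affine function of
  \<open>exp (-\<bar>p\<bar> * D)\<close>, where \<open>D\<close> is the rescaled increment of \<open>\<tau>\<close>, and the law of large numbers applies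
  to these exponentials. The limit \<open>g\<close> does not depend on the window, and since it is strictly
  increasing it identifies \<open>p\<close>.\<close>

lemma stable_subordinator_rescaled_mean_tendsto:
  assumes sub: "stable_subordinator \<alpha> \<tau>"
  obtains g :: "real \<Rightarrow> real" where "strict_mono g"
    and "\<And>a h p. 0 \<le> a \<Longrightarrow> 0 < h \<Longrightarrow>
           AE \<omega> in M. (\<lambda>n. rescaled_mean \<alpha> a h n (\<lambda>l. p * \<tau> l \<omega>)) \<longlonglongrightarrow> g p"
proof -
  note sub' = sub [unfolded stable_subordinator_def]
  have \<alpha>: "0 < \<alpha>"
    using sub' by (elim conjE)
  have rv: "random_variable borel (\<tau> l)" if "0 \<le> l" for l
  proof -
    have "\<forall>l\<ge>0. random_variable borel (\<tau> l)" using sub' by (elim conjE)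
    from this[rule_format, OF that] show ?thesis .
  qed
  have zero: "\<tau> 0 \<omega> = 0" if "\<omega> \<in> space M" for \<omega>
  proof -
    have "\<forall>\<omega>\<in>space M. \<tau> 0 \<omega> = 0" using sub' by (elim conjE)
    from this[rule_format, OF that] show ?thesis .
  qed
  have mono: "mono_on {0..} (\<lambda>l. \<tau> l \<omega>)" if "\<omega> \<in> space M" for \<omega>
  proof -
    have "\<forall>\<omega>\<in>space M. mono_on {0..} (\<lambda>l. \<tau> l \<omega>)" using sub' by (elim conjE)
    from this[rule_format, OF that] show ?thesis .
  qed
  have stat: "distr M borel (\<lambda>\<omega>. \<tau> (l + h) \<omega> - \<tau> l \<omega>) = distr M borel (\<lambda>\<omega>. \<tau> h \<omega> - \<tau> 0 \<omega>)"
    if "0 \<le> l" "0 \<le> h" for l h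
  proof -
    have "\<forall>l\<ge>0. \<forall>h\<ge>0. distr M borel (\<lambda>\<omega>. \<tau> (l + h) \<omega> - \<tau> l \<omega>) =
        distr M borel (\<lambda>\<omega>. \<tau> h \<omega> - \<tau> 0 \<omega>)"
      using sub' by (elim conjE)
    from this[rule_format, OF that] show ?thesis .
  qed
  have indep: "indep_vars (\<lambda>_. borel) (\<lambda>i \<omega>. \<tau> (t (Suc i)) \<omega> - \<tau> (t i) \<omega>) {..<n}"
    if "0 \<le> t 0" "mono_on {..n} t" for n and t :: "nat \<Rightarrow> real"
  proof -
    have "\<forall>n. \<forall>t :: nat \<Rightarrow> real. 0 \<le> t 0 \<and> mono_on {..n} t \<longrightarrow>
        indep_vars (\<lambda>_. borel) (\<lambda>i \<omega>. \<tau> (t (Suc i)) \<omega> - \<tau> (t i) \<omega>) {..<n}"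
      using sub' by (elim conjE)
    from this[rule_format, OF conjI, OF that] show ?thesis .
  qed
  obtain c where c: "0 < c" and laplace:
    "\<forall>q\<ge>0. \<forall>l\<ge>0. expectation (\<lambda>\<omega>. exp (- q * \<tau> l \<omega>)) = exp (- c * l * q powr \<alpha>)"
    using sub' by (elim conjE exE)
  have lap: "expectation (\<lambda>\<omega>. exp (- q * \<tau> l \<omega>)) = exp (- c * l * q powr \<alpha>)"
    if "0 \<le> q" "0 \<le> l" for q l
    using laplace[rule_format, OF that] .
  \<comment> \<open>In this form \<open>g\<close> is strictly increasing as a composition of such functions; the equation \<open>g_eq\<close>
    gives the form in which it arises as a limit.\<close>
  define g where "g p = saturate (sgn p * (c * \<bar>p\<bar> powr \<alpha>))" for p
  have g_eq: "g p = sgn p * (1 - exp (- c * \<bar>p\<bar> powr \<alpha>))" for p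
    using c unfolding g_def by (subst saturate_mult_nonneg) (auto simp: abs_sgn_eq sgn_if)
  have "strict_mono g"
  proof (rule strict_monoI)
    fix x y :: real
    assume "x < y"
    consider "0 \<le> x" | "x < 0" "0 < y" | "y \<le> 0" by linarith
    then have "sgn x * (c * \<bar>x\<bar> powr \<alpha>) < sgn y * (c * \<bar>y\<bar> powr \<alpha>)"
    proof cases
      case 1
      then show ?thesis using \<open>x < y\<close> c \<alpha> powr_less_mono2[of \<alpha> x y] by (auto simp: sgn_if)
    next
      case 2
      then have "sgn x * (c * \<bar>x\<bar> powr \<alpha>) < 0" "0 < sgn y * (c * \<bar>y\<bar> powr \<alpha>)"
        using c by auto
      then show ?thesis by linarith
    next
      case 3
      then show ?thesis using \<open>x < y\<close> c \<alpha> powr_less_mono2[of \<alpha> "- y" "- x"] by (auto simp: sgn_if)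
    qed
    then show "g x < g y"
      unfolding g_def by (rule strict_monoD[OF saturate_strict_mono])
  qed
  moreover have "AE \<omega> in M. (\<lambda>n. rescaled_mean \<alpha> a h n (\<lambda>l. p * \<tau> l \<omega>)) \<longlonglongrightarrow> g p"
    if a: "0 \<le> a" and h: "0 < h" for a h p
  proof -
    define D where "D n j \<omega> = \<tau> (grid a h n (Suc j)) \<omega> - \<tau> (grid a h n j) \<omega>" for n j \<omega>
    define V where "V n j \<omega> = exp (- \<bar>p\<bar> * ((h / 2 ^ n) powr (- 1 / \<alpha>) * D n j \<omega>))" for n j \<omega>
    have D_nonneg: "0 \<le> D n j \<omega>" if "\<omega> \<in> space M" for n j \<omega>
    proof -
      have "0 \<le> grid a h n j" "grid a h n j \<le> grid a h n (Suc j)"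
        using a h order.trans[OF a grid_ge] by (auto intro: monoD[OF mono_grid])
      then show ?thesis
        using mono_onD[OF mono[OF that]] by (auto simp: D_def)
    qed
    have "AE \<omega> in M. (\<lambda>n. (\<Sum>j<2 ^ n. V n j \<omega>) / 2 ^ n) \<longlonglongrightarrow> exp (- c * \<bar>p\<bar> powr \<alpha>)"
    proof (rule dyadic_array_lln)
      show "indep_vars (\<lambda>_. borel) (V n) {..<2 ^ n}" for n
      proof -
        have "indep_vars (\<lambda>_. borel) (D n) {..<2 ^ n}"
          unfolding D_def [abs_def]
        proof (rule indep)
          show "0 \<le> grid a h n 0"
            using a by (simp add: grid_def)
          show "mono_on {..2 ^ n} (grid a h n)"
            using h mono_grid[of h a n] by (auto intro: mono_on_subset)
        qed
        then show ?thesis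
          unfolding V_def [abs_def]
          by (rule indep_vars_compose2
              [where Y = "\<lambda>_ d. exp (- \<bar>p\<bar> * ((h / 2 ^ n) powr (- 1 / \<alpha>) * d))"]) measurable
      qed
      show "V n j \<omega> \<in> {0..1}" if "\<omega> \<in> space M" for n j \<omega>
        using D_nonneg[OF that] by (auto simp: V_def)
      show "expectation (V n j) = exp (- c * \<bar>p\<bar> powr \<alpha>)" for n j
      proof -
        have step: "grid a h n (Suc j) = grid a h n j + h / 2 ^ n"
          by (simp add: grid_def algebra_simps add_divide_distrib)
        have grid_nonneg: "0 \<le> grid a h n j"
          using grid_ge[of h a n j] a h by linarith
        have "expectation (\<lambda>\<omega>. exp (- \<bar>p\<bar> * ((h / 2 ^ n) powr (- 1 / \<alpha>) *
            (\<tau> (grid a h n j + h / 2 ^ n) \<omega> - \<tau> (grid a h n j) \<omega>)))) = exp (- c * \<bar>p\<bar> powr \<alpha>)"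
        proof (rule stable_increment_laplace[where c = c])
          show "distr M borel (\<lambda>\<omega>. \<tau> (grid a h n j + h / 2 ^ n) \<omega> - \<tau> (grid a h n j) \<omega>)
              = distr M borel (\<lambda>\<omega>. \<tau> (h / 2 ^ n) \<omega> - \<tau> 0 \<omega>)"
            using grid_nonneg h by (intro stat) auto
          show "expectation (\<lambda>\<omega>. exp (- q * \<tau> (h / 2 ^ n) \<omega>)) = exp (- c * (h / 2 ^ n) * q powr \<alpha>)"
            if "0 \<le> q" for q
            using that h by (intro lap) auto
        qed (use grid_nonneg \<alpha> h in \<open>auto intro: rv zero\<close>)
        then show ?thesis
          unfolding V_def [abs_def] D_def step .
      qed
    qed
    then show ?thesis
    proof (rule AE_mp, intro AE_I2 impI)
      fix \<omega>
      assume \<omega>: "\<omega> \<in> space M"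
        and lim: "(\<lambda>n. (\<Sum>j<2 ^ n. V n j \<omega>) / 2 ^ n) \<longlonglongrightarrow> exp (- c * \<bar>p\<bar> powr \<alpha>)"
      have "rescaled_mean \<alpha> a h n (\<lambda>l. p * \<tau> l \<omega>) = sgn p * (1 - (\<Sum>j<2 ^ n. V n j \<omega>) / 2 ^ n)" for n
      proof -
        have "saturate ((h / 2 ^ n) powr (- 1 / \<alpha>) * (p * \<tau> (grid a h n (Suc j)) \<omega> - p * \<tau> (grid a h n j) \<omega>))
            = sgn p * (1 - V n j \<omega>)" for j
        proof -
          have "(h / 2 ^ n) powr (- 1 / \<alpha>) * (p * \<tau> (grid a h n (Suc j)) \<omega> - p * \<tau> (grid a h n j) \<omega>)
              = p * ((h / 2 ^ n) powr (- 1 / \<alpha>) * D n j \<omega>)"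
            unfolding D_def right_diff_distrib by (simp only: mult.left_commute)
          then show ?thesis
            unfolding V_def using D_nonneg[OF \<omega>]
            by (simp only:) (intro saturate_mult_nonneg mult_nonneg_nonneg, auto)
        qed
        then have "rescaled_mean \<alpha> a h n (\<lambda>l. p * \<tau> l \<omega>) = (\<Sum>j<2 ^ n. sgn p * (1 - V n j \<omega>)) / 2 ^ n"
          by (simp only: rescaled_mean_def)
        also have "\<dots> = sgn p * ((2 ^ n - (\<Sum>j<2 ^ n. V n j \<omega>)) / 2 ^ n)"
          by (simp only: sum_distrib_left[symmetric] sum_subtractf) simp
        also have "\<dots> = sgn p * (1 - (\<Sum>j<2 ^ n. V n j \<omega>) / 2 ^ n)"
          by (simp only: diff_divide_distrib) simp
        finally show ?thesis .
      qed
      then show "(\<lambda>n. rescaled_mean \<alpha> a h n (\<lambda>l. p * \<tau> l \<omega>)) \<longlonglongrightarrow> g p"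
        unfolding g_eq by (simp only:) (intro tendsto_intros lim)
    qed
  qed
  ultimately show thesis by (rule that)
qed

end

section \<open>Recovering the integrand from the time-changed integral\<close>

lemma integral_process_diff:
  fixes X :: "real \<Rightarrow> 'a \<Rightarrow> 'b::euclidean_space"
  assumes int: "\<And>u. 0 \<le> u \<Longrightarrow> set_integrable lborel {0..u} (\<lambda>s. X s \<omega>)" and uv: "0 \<le> u" "u \<le> v"
  shows "(integral_process X v \<omega> - integral_process X u \<omega>) \<bullet> b = (LINT s:{u<..v}|lborel. X s \<omega> \<bullet> b)"
    and "set_integrable lborel {u<..v} (\<lambda>s. X s \<omega> \<bullet> b)"
proof -
  have split: "{0..v} = {0..u} \<union> {u<..v}" "{0..u} \<inter> {u<..v} = {}"
    using uv by auto
  have int_uv: "set_integrable lborel {u<..v} (\<lambda>s. X s \<omega>)"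
    using uv by (intro set_integrable_subset[OF int[of v]]) auto
  have "integral_process X v \<omega> = integral_process X u \<omega> + (LINT s:{u<..v}|lborel. X s \<omega>)"
    unfolding integral_process_def split(1)
    by (intro set_integral_Un split(2) int uv int_uv)
  then show "(integral_process X v \<omega> - integral_process X u \<omega>) \<bullet> b = (LINT s:{u<..v}|lborel. X s \<omega> \<bullet> b)"
    using int_uv
    by (simp add: set_lebesgue_integral_def set_integrable_def flip: integral_inner_left)
  show "set_integrable lborel {u<..v} (\<lambda>s. X s \<omega> \<bullet> b)"
    using integrable_inner_left[of b lborel "\<lambda>s. indicat_real {u<..v} s *\<^sub>R X s \<omega>"] int_uv
    by (simp add: set_integrable_def)
qed

lemma integral_process_diff_bounds:
  fixes X :: "real \<Rightarrow> 'a \<Rightarrow> 'b::euclidean_space"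
  assumes int: "\<And>u. 0 \<le> u \<Longrightarrow> set_integrable lborel {0..u} (\<lambda>s. X s \<omega>)" and uv: "0 \<le> u" "u \<le> v"
  shows "(\<And>s. u \<le> s \<Longrightarrow> s \<le> v \<Longrightarrow> X s \<omega> \<bullet> b \<le> p) \<Longrightarrow>
           (integral_process X v \<omega> - integral_process X u \<omega>) \<bullet> b \<le> p * (v - u)"
    and "(\<And>s. u \<le> s \<Longrightarrow> s \<le> v \<Longrightarrow> p \<le> X s \<omega> \<bullet> b) \<Longrightarrow>
           p * (v - u) \<le> (integral_process X v \<omega> - integral_process X u \<omega>) \<bullet> b"
proof -
  have diff: "(integral_process X v \<omega> - integral_process X u \<omega>) \<bullet> b = (LINT s:{u<..v}|lborel. X s \<omega> \<bullet> b)"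
    "set_integrable lborel {u<..v} (\<lambda>s. X s \<omega> \<bullet> b)"
    by (rule integral_process_diff[where X = X, OF int uv]; assumption)+
  have const: "(LINT s:{u<..v}|lborel. p) = p * (v - u)" "set_integrable lborel {u<..v} (\<lambda>s. p)"
    using uv by (auto simp: set_lebesgue_integral_def set_integrable_def)
  show "(integral_process X v \<omega> - integral_process X u \<omega>) \<bullet> b \<le> p * (v - u)"
    if "\<And>s. u \<le> s \<Longrightarrow> s \<le> v \<Longrightarrow> X s \<omega> \<bullet> b \<le> p"
    unfolding diff(1) const(1)[symmetric] by (intro set_integral_mono diff const that) auto
  show "p * (v - u) \<le> (integral_process X v \<omega> - integral_process X u \<omega>) \<bullet> b"
    if "\<And>s. u \<le> s \<Longrightarrow> s \<le> v \<Longrightarrow> p \<le> X s \<omega> \<bullet> b"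
    unfolding diff(1) const(1)[symmetric] by (intro set_integral_mono diff const that) auto
qed

text \<open>Right-continuity of \<open>T\<close> at \<open>k\<close> brings the span \<open>[T k, T (e m)]\<close> down to the point \<open>T k\<close> (there is
  no jump just after \<open>k\<close>), and right-continuity of \<open>x\<close> at \<open>T k\<close> then confines \<open>x\<close> on this span.\<close>

lemma right_limit_along_time_change:
  fixes x :: "real \<Rightarrow> 'b::topological_space" and T :: "real \<Rightarrow> real"
  assumes T: "continuous (at_right k) T"
    and x: "continuous (at_right (T k)) x"
    and e: "\<And>m. k < e m" "e \<longlonglongrightarrow> k"
    and S: "open S" "x (T k) \<in> S"
  shows "\<forall>\<^sub>F m in sequentially. \<forall>s. T k \<le> s \<longrightarrow> s \<le> T (e m) \<longrightarrow> x s \<in> S"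
proof -
  have "\<forall>\<^sub>F s in at_right (T k). x s \<in> S"
    using x S by (auto simp: continuous_within tendsto_def)
  then obtain d where d: "T k < d" "\<And>s. T k < s \<Longrightarrow> s < d \<Longrightarrow> x s \<in> S"
    by (auto simp: eventually_at_right_field)
  have "filterlim e (at_right k) sequentially"
    using e less_imp_neq[OF e(1)] by (simp add: filterlim_at always_eventually neq_commute)
  then have "(\<lambda>m. T (e m)) \<longlonglongrightarrow> T k"
    using T by (auto simp: continuous_within intro: filterlim_compose)
  then have "\<forall>\<^sub>F m in sequentially. T (e m) < d"
    using d(1) by (rule order_tendstoD)
  then show ?thesis
  proof eventually_elim
    case (elim m)
    show ?case
    proof (intro allI impI)
      fix s assume "T k \<le> s" "s \<le> T (e m)"
      then show "x s \<in> S"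
        using d(2)[of s] elim S(2) by (cases "s = T k") auto
    qed
  qed
qed

text \<open>This is the heart of the argument, for a single path. On windows close to \<open>k\<close> the averages of
  \<open>Y\<^sub>\<tau> \<bullet> b\<close> dominate those of \<open>p * \<tau>\<close> when \<open>p < X\<^bsub>\<tau> k\<^esub> \<bullet> b\<close> and are dominated by them
  when \<open>X\<^bsub>\<tau> k\<^esub> \<bullet> b < p\<close>. A rational \<open>p\<close> strictly between \<open>q\<close> and \<open>X\<^bsub>\<tau> k\<^esub> \<bullet> b\<close> leaves room to pass
  from the limit \<open>g p\<close>, which differs from \<open>g q\<close>, to the averages with finite \<open>n\<close>. The order of the quantifiers
  matters: the window is fixed first, and its mesh is refined afterwards.\<close>

lemma less_time_change_iff:
  fixes X :: "real \<Rightarrow> 'a \<Rightarrow> 'b::euclidean_space"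
  assumes X: "\<And>s. 0 \<le> s \<Longrightarrow> continuous (at_right s) (\<lambda>s. X s \<omega>)"
    and int: "\<And>u. 0 \<le> u \<Longrightarrow> set_integrable lborel {0..u} (\<lambda>s. X s \<omega>)"
    and zero: "\<tau> 0 \<omega> = 0"
    and mono: "mono_on {0..} (\<lambda>l. \<tau> l \<omega>)"
    and \<tau>: "continuous (at_right k) (\<lambda>l. \<tau> l \<omega>)"
    and k: "0 \<le> k"
    and a: "\<And>m. k \<le> a m" and h: "\<And>m. 0 < h m" and lim: "(\<lambda>m. a m + h m) \<longlonglongrightarrow> k"
    and g: "strict_mono g"
    and lln: "\<And>m p. p \<in> \<rat> \<Longrightarrow>
      (\<lambda>n. rescaled_mean \<alpha> (a m) (h m) n (\<lambda>l. p * \<tau> l \<omega>)) \<longlonglongrightarrow> g p"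
  shows "r < time_change X \<tau> k \<omega> \<bullet> b \<longleftrightarrow>
    (\<exists>q\<in>\<rat>. r < q \<and> (\<forall>\<^sub>F m in sequentially. \<forall>\<^sub>F n in sequentially.
       g q < rescaled_mean \<alpha> (a m) (h m) n (\<lambda>l. time_change (integral_process X) \<tau> l \<omega> \<bullet> b)))"
    (is "_ \<longleftrightarrow> (\<exists>q\<in>\<rat>. r < q \<and> (\<forall>\<^sub>F m in _. \<forall>\<^sub>F n in _. g q < ?R m n))")
proof -
  have \<tau>_mono: "\<tau> u \<omega> \<le> \<tau> v \<omega>" if "0 \<le> u" "u \<le> v" for u v
    using mono_onD[OF mono, of u v] that by auto
  have \<tau>_nonneg: "0 \<le> \<tau> u \<omega>" if "0 \<le> u" for u
    using \<tau>_mono[of 0 u] that zero by auto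
  have after: "k < a m + h m" for m
    using a[of m] h[of m] by simp
  have near: "\<forall>\<^sub>F m in sequentially. \<forall>s. \<tau> k \<omega> \<le> s \<longrightarrow> s \<le> \<tau> (a m + h m) \<omega> \<longrightarrow> X s \<omega> \<in> S"
    if "open S" "time_change X \<tau> k \<omega> \<in> S" for S
    using right_limit_along_time_change[where T = "\<lambda>l. \<tau> l \<omega>" and x = "\<lambda>s. X s \<omega>" and S = S
        and k = k and e = "\<lambda>m. a m + h m", OF \<tau> X[OF \<tau>_nonneg[OF k]] after lim] that
    by (simp add: time_change_def)
  have window: "\<tau> k \<omega> \<le> \<tau> u \<omega>" "0 \<le> \<tau> u \<omega>" "\<tau> u \<omega> \<le> \<tau> v \<omega>" "\<tau> v \<omega> \<le> \<tau> (a m + h m) \<omega>"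
    if "a m \<le> u" "u \<le> v" "v \<le> a m + h m" for u v m
    using that a[of m] k by (auto intro!: \<tau>_mono \<tau>_nonneg)
  have below: "\<forall>\<^sub>F m in sequentially. \<forall>n. rescaled_mean \<alpha> (a m) (h m) n (\<lambda>l. p * \<tau> l \<omega>) \<le> ?R m n"
    if "p < time_change X \<tau> k \<omega> \<bullet> b" for p
  proof -
    have "\<forall>\<^sub>F m in sequentially. \<forall>s. \<tau> k \<omega> \<le> s \<longrightarrow> s \<le> \<tau> (a m + h m) \<omega> \<longrightarrow> p < X s \<omega> \<bullet> b"
      using near[OF open_halfspace_component_gt[of p b]] that by simp
    then show ?thesis
    proof eventually_elim
      case (elim m)
      show ?case
      proof (intro allI rescaled_mean_mono less_imp_le[OF h])
        fix u v assume uv: "a m \<le> u" "u \<le> v" "v \<le> a m + h m"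
        show "p * \<tau> v \<omega> - p * \<tau> u \<omega> \<le> time_change (integral_process X) \<tau> v \<omega> \<bullet> b - time_change (integral_process X) \<tau> u \<omega> \<bullet> b"
          using integral_process_diff_bounds(2)[where X = X, OF int window(2)[OF uv] window(3)[OF uv], where p = p and b = b]
            elim window(1)[OF uv] window(4)[OF uv]
          by (fastforce simp: time_change_def inner_diff_left right_diff_distrib intro: less_imp_le)
      qed
    qed
  qed
  have above: "\<forall>\<^sub>F m in sequentially. \<forall>n. ?R m n \<le> rescaled_mean \<alpha> (a m) (h m) n (\<lambda>l. p * \<tau> l \<omega>)"
    if "time_change X \<tau> k \<omega> \<bullet> b < p" for p
  proof -
    have "\<forall>\<^sub>F m in sequentially. \<forall>s. \<tau> k \<omega> \<le> s \<longrightarrow> s \<le> \<tau> (a m + h m) \<omega> \<longrightarrow> X s \<omega> \<bullet> b < p"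
      using near[OF open_halfspace_component_lt[of b p]] that by simp
    then show ?thesis
    proof eventually_elim
      case (elim m)
      show ?case
      proof (intro allI rescaled_mean_mono less_imp_le[OF h])
        fix u v assume uv: "a m \<le> u" "u \<le> v" "v \<le> a m + h m"
        show "time_change (integral_process X) \<tau> v \<omega> \<bullet> b - time_change (integral_process X) \<tau> u \<omega> \<bullet> b \<le> p * \<tau> v \<omega> - p * \<tau> u \<omega>"
          using integral_process_diff_bounds(1)[where X = X, OF int window(2)[OF uv] window(3)[OF uv], where p = p and b = b]
            elim window(1)[OF uv] window(4)[OF uv]
          by (fastforce simp: time_change_def inner_diff_left right_diff_distrib intro: less_imp_le)
      qed
    qed
  qed
  show ?thesis
  proof
    assume "r < time_change X \<tau> k \<omega> \<bullet> b"
    then obtain p where p: "p \<in> \<rat>" "r < p" "p < time_change X \<tau> k \<omega> \<bullet> b"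
      using Rats_dense_in_real by blast
    then obtain q where q: "q \<in> \<rat>" "r < q" "q < p"
      using Rats_dense_in_real by blast
    have "\<forall>\<^sub>F m in sequentially. \<forall>\<^sub>F n in sequentially. g q < ?R m n"
      using below[OF p(3)]
    proof eventually_elim
      case (elim m)
      have "\<forall>\<^sub>F n in sequentially. g q < rescaled_mean \<alpha> (a m) (h m) n (\<lambda>l. p * \<tau> l \<omega>)"
        using order_tendstoD(1)[OF lln[OF p(1)]] strict_monoD[OF g q(3)] by blast
      then show ?case
        by (rule eventually_mono) (use elim less_le_trans in blast)
    qed
    then show "\<exists>q\<in>\<rat>. r < q \<and> (\<forall>\<^sub>F m in sequentially. \<forall>\<^sub>F n in sequentially. g q < ?R m n)"
      using q by blast
  next
    assume "\<exists>q\<in>\<rat>. r < q \<and> (\<forall>\<^sub>F m in sequentially. \<forall>\<^sub>F n in sequentially. g q < ?R m n)"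
    then obtain q where q: "r < q" "\<forall>\<^sub>F m in sequentially. \<forall>\<^sub>F n in sequentially. g q < ?R m n"
      by blast
    show "r < time_change X \<tau> k \<omega> \<bullet> b"
    proof (rule ccontr)
      assume "\<not> r < time_change X \<tau> k \<omega> \<bullet> b"
      then obtain p where p: "p \<in> \<rat>" "time_change X \<tau> k \<omega> \<bullet> b < p" "p < q"
        using Rats_dense_in_real[of "max r (time_change X \<tau> k \<omega> \<bullet> b)" q] q(1) by auto
      have "\<forall>\<^sub>F m in sequentially. False"
        using q(2) above[OF p(2)]
      proof eventually_elim
        case (elim m)
        have "\<forall>\<^sub>F n in sequentially. rescaled_mean \<alpha> (a m) (h m) n (\<lambda>l. p * \<tau> l \<omega>) < g q"
          using order_tendstoD(2)[OF lln[OF p(1)]] strict_monoD[OF g p(3)] by blast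
        with elim(1) have "\<forall>\<^sub>F n :: nat in sequentially. False"
          by eventually_elim (use elim(2) in \<open>meson less_le_trans not_less_iff_gr_or_eq\<close>)
        then show ?case by simp
      qed
      then show False by simp
    qed
  qed
qed

section \<open>Measurability and containment of filtrations\<close>

lemma borel_measurable_rescaled_mean:
  assumes "0 \<le> h"
    and Z: "\<And>u. a \<le> u \<Longrightarrow> u \<le> a + h \<Longrightarrow> Z u \<in> borel_measurable N"
  shows "(\<lambda>\<omega>. rescaled_mean \<alpha> a h n (\<lambda>u. Z u \<omega>)) \<in> borel_measurable N"
proof -
  have Z_grid: "Z (grid a h n j) \<in> borel_measurable N" if "j \<le> 2 ^ n" for j
    using that assms(1) by (intro Z grid_ge grid_le)
  have "(\<lambda>\<omega>. saturate ((h / 2 ^ n) powr (- 1 / \<alpha>) * (Z (grid a h n (Suc j)) \<omega> - Z (grid a h n j) \<omega>)))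
      \<in> borel_measurable N" if "j < 2 ^ n" for j
  proof -
    have [measurable]: "Z (grid a h n j) \<in> borel_measurable N" "Z (grid a h n (Suc j)) \<in> borel_measurable N"
      using that by (auto intro: Z_grid)
    show ?thesis by measurable
  qed
  then show ?thesis
    unfolding rescaled_mean_def
    by (rule borel_measurable_divide[OF borel_measurable_sum borel_measurable_const]) simp
qed

text \<open>The measure \<open>N\<close> only carries a \<open>\<sigma>\<close>-field here, typically the one generated by \<open>Y\<^sub>\<tau>\<close> up to
  the index \<open>k'\<close> on the complement of a null event. All windows are chosen between \<open>k\<close> and \<open>k'\<close>.\<close>

lemma borel_measurable_time_change:
  fixes X :: "real \<Rightarrow> 'a \<Rightarrow> 'b::euclidean_space"
  assumes X: "\<And>\<omega> s. \<omega> \<in> space N \<Longrightarrow> 0 \<le> s \<Longrightarrow> continuous (at_right s) (\<lambda>s. X s \<omega>)"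
    and int: "\<And>\<omega> u. \<omega> \<in> space N \<Longrightarrow> 0 \<le> u \<Longrightarrow> set_integrable lborel {0..u} (\<lambda>s. X s \<omega>)"
    and zero: "\<And>\<omega>. \<omega> \<in> space N \<Longrightarrow> \<tau> 0 \<omega> = 0"
    and mono: "\<And>\<omega>. \<omega> \<in> space N \<Longrightarrow> mono_on {0..} (\<lambda>l. \<tau> l \<omega>)"
    and \<tau>: "\<And>\<omega>. \<omega> \<in> space N \<Longrightarrow> continuous (at_right k) (\<lambda>l. \<tau> l \<omega>)"
    and g: "strict_mono g"
    and lln: "\<And>\<omega> a h p. \<omega> \<in> space N \<Longrightarrow> a \<in> \<rat> \<Longrightarrow> 0 \<le> a \<Longrightarrow> h \<in> \<rat> \<Longrightarrow> 0 < h \<Longrightarrow> p \<in> \<rat> \<Longrightarrow>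
      (\<lambda>n. rescaled_mean \<alpha> a h n (\<lambda>l. p * \<tau> l \<omega>)) \<longlonglongrightarrow> g p"
    and k: "0 \<le> k" "k < k'"
    and Y: "\<And>u. 0 \<le> u \<Longrightarrow> u \<le> k' \<Longrightarrow> time_change (integral_process X) \<tau> u \<in> borel_measurable N"
  shows "time_change X \<tau> k \<in> borel_measurable N"
proof -
  \<comment> \<open>Both the offset from \<open>k\<close> and the length of window \<open>m\<close> lie below \<open>e m\<close>, so the window ends before \<open>k'\<close>.\<close>
  define e where "e m = (k' - k) / 2 * inverse (real (Suc m))" for m
  have e: "0 < e m" "e m \<le> (k' - k) / 2" for m
    using k(2) mult_left_mono[of "inverse (real (Suc m))" 1 "(k' - k) / 2"]
    by (auto simp: e_def inverse_le_1_iff)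
  have "e \<longlonglongrightarrow> 0"
    unfolding e_def [abs_def] by (intro tendsto_mult_right_zero LIMSEQ_inverse_real_of_nat)
  have "\<exists>a\<in>\<rat>. k < a \<and> a < k + e m" "\<exists>h\<in>\<rat>. 0 < h \<and> h < e m" for m
    using e(1)[of m] by (intro Rats_dense_in_real; simp)+
  then obtain a h where a: "\<And>m. a m \<in> \<rat>" "\<And>m. k < a m" "\<And>m. a m < k + e m"
    and h: "\<And>m. h m \<in> \<rat>" "\<And>m. 0 < h m" "\<And>m. h m < e m"
    by metis
  have ah: "k \<le> a m" "0 \<le> a m" "k \<le> a m + h m" "a m + h m \<le> k + 2 * e m" "a m + h m \<le> k'" for m
    using a(2,3)[of m] h(2,3)[of m] e(2)[of m] k by auto
  have lim: "(\<lambda>m. a m + h m) \<longlonglongrightarrow> k"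
  proof (rule tendsto_sandwich[OF _ _ tendsto_const])
    show "(\<lambda>m. k + 2 * e m) \<longlonglongrightarrow> k"
      using tendsto_add[OF tendsto_const tendsto_mult[OF tendsto_const \<open>e \<longlonglongrightarrow> 0\<close>], of k 2] by simp
  qed (simp_all add: ah)
  have "(\<lambda>\<omega>. time_change X \<tau> k \<omega> \<bullet> b) \<in> borel_measurable N" for b
    unfolding borel_measurable_iff_greater
  proof
    fix r
    have [measurable]: "(\<lambda>\<omega>. rescaled_mean \<alpha> (a m) (h m) n
        (\<lambda>l. time_change (integral_process X) \<tau> l \<omega> \<bullet> b)) \<in> borel_measurable N" for m n
    proof (rule borel_measurable_rescaled_mean)
      fix u assume "a m \<le> u" "u \<le> a m + h m"
      then have [measurable]: "time_change (integral_process X) \<tau> u \<in> borel_measurable N"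
        using ah(2,5)[of m] by (intro Y) auto
      show "(\<lambda>\<omega>. time_change (integral_process X) \<tau> u \<omega> \<bullet> b) \<in> borel_measurable N"
        by measurable
    qed (use h(2)[of m] in simp)
    have iff: "r < time_change X \<tau> k \<omega> \<bullet> b \<longleftrightarrow>
      (\<exists>q\<in>\<rat>. r < q \<and> (\<forall>\<^sub>F m in sequentially. \<forall>\<^sub>F n in sequentially.
         g q < rescaled_mean \<alpha> (a m) (h m) n (\<lambda>l. time_change (integral_process X) \<tau> l \<omega> \<bullet> b)))"
      if "\<omega> \<in> space N" for \<omega>
      by (rule less_time_change_iff)
        (fact X[OF that] int[OF that] zero[OF that] mono[OF that] \<tau>[OF that] k(1) ah(1) h(2) lim g
          lln[OF that a(1) ah(2) h(1,2)])+
    have "{\<omega> \<in> space N. r < time_change X \<tau> k \<omega> \<bullet> b} =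
      (\<Union>q\<in>\<rat> \<inter> {r<..}. {\<omega> \<in> space N. \<forall>\<^sub>F m in sequentially. \<forall>\<^sub>F n in sequentially.
         g q < rescaled_mean \<alpha> (a m) (h m) n (\<lambda>l. time_change (integral_process X) \<tau> l \<omega> \<bullet> b)})"
      using iff by auto
    also have "\<dots> \<in> sets N"
      by (intro sets.countable_UN'' countable_Int1 countable_rat) measurable
    finally show "{\<omega> \<in> space N. r < time_change X \<tau> k \<omega> \<bullet> b} \<in> sets N" .
  qed
  then show ?thesis
    by (subst borel_measurable_euclidean_space) simp
qed

text \<open>It suffices to be adapted to the raw filtration of \<open>W\<close> at every strictly later index, because
  a right-continuous filtration allows this look-ahead: half of \<open>\<epsilon>\<close> is spent on \<open>Z\<close> and the other
  half on the look-ahead.\<close>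

lemma rc_filtration_subsetI:
  assumes meas: "\<And>k k'. 0 \<le> k \<Longrightarrow> k < k' \<Longrightarrow>
      Z k \<in> borel_measurable (sigma \<Omega> {W j -` A \<inter> \<Omega> |j A. j \<in> {0..k'} \<and> A \<in> sets borel})"
    and l: "0 \<le> l"
  shows "rc_filtration \<Omega> Z l \<subseteq> rc_filtration \<Omega> W l"
  unfolding rc_filtration_def
proof (rule INT_greatest)
  fix \<epsilon> :: real assume "\<epsilon> \<in> {0<..}"
  then have \<epsilon>: "0 < \<epsilon>" by simp
  define \<G> where "\<G> = {W j -` A \<inter> \<Omega> |j A. j \<in> {0..l + \<epsilon>} \<and> A \<in> sets borel}"
  have \<G>: "\<G> \<subseteq> Pow \<Omega>" by (auto simp: \<G>_def)
  have "Z k -` A \<inter> \<Omega> \<in> sigma_sets \<Omega> \<G>" if "k \<in> {0..l + \<epsilon> / 2}" "A \<in> sets borel" for k A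
  proof -
    have "Z k \<in> borel_measurable (sigma \<Omega> \<G>)"
      unfolding \<G>_def using that(1) \<epsilon> by (intro meas) auto
    from measurable_sets[OF this that(2)] show ?thesis
      using \<G> by (simp add: sets_measure_of space_measure_of)
  qed
  then have "sigma_sets \<Omega> {Z k -` A \<inter> \<Omega> |k A. k \<in> {0..l + \<epsilon> / 2} \<and> A \<in> sets borel} \<subseteq> sigma_sets \<Omega> \<G>"
    by (intro sigma_sets_mono) blast
  moreover have "(\<Inter>\<epsilon>\<in>{0<..}. sigma_sets \<Omega> {Z k -` A \<inter> \<Omega> |k A. k \<in> {0..l + \<epsilon>} \<and> A \<in> sets borel})
      \<subseteq> sigma_sets \<Omega> {Z k -` A \<inter> \<Omega> |k A. k \<in> {0..l + \<epsilon> / 2} \<and> A \<in> sets borel}"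
    by (rule INT_lower) (use \<epsilon> in simp)
  ultimately show "(\<Inter>\<epsilon>\<in>{0<..}. sigma_sets \<Omega> {Z k -` A \<inter> \<Omega> |k A. k \<in> {0..l + \<epsilon>} \<and> A \<in> sets borel})
      \<subseteq> sigma_sets \<Omega> {W k -` A \<inter> \<Omega> |k A. k \<in> {0..l + \<epsilon>} \<and> A \<in> sets borel}"
    unfolding \<G>_def by blast
qed

theorem theorem1:
  fixes M :: "'a measure" and X :: "real \<Rightarrow> 'a \<Rightarrow> real ^ 'd"
    and \<tau> :: "real \<Rightarrow> 'a \<Rightarrow> real" and \<alpha> :: real
  assumes "prob_space M"
    and "\<And>s. 0 \<le> s \<Longrightarrow> X s \<in> borel_measurable M"
    and "\<And>\<omega> s. \<omega> \<in> space M \<Longrightarrow> 0 \<le> s \<Longrightarrow> continuous (at_right s) (\<lambda>s. X s \<omega>)"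
    and "\<And>\<omega> u. \<omega> \<in> space M \<Longrightarrow> 0 \<le> u \<Longrightarrow> set_integrable lborel {0..u} (\<lambda>s. X s \<omega>)"
    and "prob_space.stable_subordinator M \<alpha> \<tau>"
  shows "ae_contains_filtration M (time_change (integral_process X) \<tau>) (time_change X \<tau>)"
proof -
  interpret prob_space M by fact
  note sub = assms(5) [unfolded stable_subordinator_def]
  have zero: "\<forall>\<omega>\<in>space M. \<tau> 0 \<omega> = 0"
    using sub by (elim conjE)
  have mono: "\<forall>\<omega>\<in>space M. mono_on {0..} (\<lambda>l. \<tau> l \<omega>)"
    using sub by (elim conjE)
  have rc: "\<forall>\<omega>\<in>space M. \<forall>l\<ge>0. continuous (at_right l) (\<lambda>l. \<tau> l \<omega>)"
    using sub by (elim conjE)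
  obtain g where g: "strict_mono g"
    and lln: "\<And>a h p. 0 \<le> a \<Longrightarrow> 0 < h \<Longrightarrow>
      AE \<omega> in M. (\<lambda>n. rescaled_mean \<alpha> a h n (\<lambda>l. p * \<tau> l \<omega>)) \<longlonglongrightarrow> g p"
    by (rule stable_subordinator_rescaled_mean_tendsto[OF assms(5)]) blast
  \<comment> \<open>Only countably many limits are needed, so the exceptional event \<open>N\<close> does not depend on the index.\<close>
  have "AE \<omega> in M. \<forall>a\<in>\<rat> \<inter> {0..}. \<forall>h\<in>\<rat> \<inter> {0<..}. \<forall>p\<in>\<rat>.
      (\<lambda>n. rescaled_mean \<alpha> a h n (\<lambda>l. p * \<tau> l \<omega>)) \<longlonglongrightarrow> g p"
    using lln by (simp add: AE_ball_countable countable_rat countable_Int1)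
  then obtain N where "{\<omega> \<in> space M. \<not> (\<forall>a\<in>\<rat> \<inter> {0..}. \<forall>h\<in>\<rat> \<inter> {0<..}. \<forall>p\<in>\<rat>.
      (\<lambda>n. rescaled_mean \<alpha> a h n (\<lambda>l. p * \<tau> l \<omega>)) \<longlonglongrightarrow> g p)} \<subseteq> N"
    and "emeasure M N = 0" "N \<in> sets M"
    by (rule AE_E)
  then have N: "N \<in> null_sets M"
    and lln_off: "\<And>\<omega> a h p. \<omega> \<in> space M - N \<Longrightarrow> a \<in> \<rat> \<Longrightarrow> 0 \<le> a \<Longrightarrow> h \<in> \<rat> \<Longrightarrow> 0 < h \<Longrightarrow> p \<in> \<rat> \<Longrightarrow>
      (\<lambda>n. rescaled_mean \<alpha> a h n (\<lambda>l. p * \<tau> l \<omega>)) \<longlonglongrightarrow> g p"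
    by (blast intro: null_setsI)+
  define \<Omega> where "\<Omega> = space M - N"
  have in_M: "\<omega> \<in> space M" if "\<omega> \<in> \<Omega>" for \<omega>
    using that by (simp add: \<Omega>_def)
  have "rc_filtration \<Omega> (time_change X \<tau>) l \<subseteq> rc_filtration \<Omega> (time_change (integral_process X) \<tau>) l"
    if "0 \<le> l" for l
  proof (rule rc_filtration_subsetI[OF _ that])
    fix k k' :: real assume k: "0 \<le> k" "k < k'"
    define \<G> where "\<G> = {time_change (integral_process X) \<tau> j -` A \<inter> \<Omega> |j A.
        j \<in> {0..k'} \<and> A \<in> sets borel}"
    have \<G>: "\<G> \<subseteq> Pow \<Omega>" by (auto simp: \<G>_def)
    have space: "space (sigma \<Omega> \<G>) = \<Omega>"
      using \<G> by (simp add: space_measure_of)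
    have Y: "time_change (integral_process X) \<tau> u \<in> borel_measurable (sigma \<Omega> \<G>)" if "0 \<le> u" "u \<le> k'" for u
    proof (rule measurableI)
      fix A :: "(real ^ 'd) set" assume "A \<in> sets borel"
      then have "time_change (integral_process X) \<tau> u -` A \<inter> \<Omega> \<in> \<G>"
        using that by (auto simp: \<G>_def)
      then show "time_change (integral_process X) \<tau> u -` A \<inter> space (sigma \<Omega> \<G>) \<in> sets (sigma \<Omega> \<G>)"
        unfolding space using \<G> by (simp add: sets_measure_of sigma_sets.Basic)
    qed simp
    show "time_change X \<tau> k \<in> borel_measurable (sigma \<Omega> \<G>)"
      by (rule borel_measurable_time_change[where g = g and \<alpha> = \<alpha> and k' = k'])
        (use assms(3,4) zero mono rc g lln_off [folded \<Omega>_def] k Y in \<open>auto simp: space dest: in_M\<close>)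
  qed
  then show ?thesis
    using N unfolding ae_contains_filtration_def \<Omega>_def by blast
qed

end
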